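(* Let $R=K[x_1,\ldots,x_n]$ be a polynomial ring over a field $K$, let $I\subset R$ be a monomial ideal without embedded primes, and let $I=\bigcap_{i=1}^r\mathfrak{I}_i$ be its minimal irredundant primary decomposition. Then $R_s(I)$ is normal if and only if $R[\mathfrak{I}_it]$ is normal for all $i=1,\ldots,r$.
   Context: Let $t$ be a new variable. The Rees algebra of an ideal $J\subset R$ is $R[Jt]=R\oplus Jt\oplus\cdots\oplus J^kt^k\oplus\cdots\subset R[t]$. The symbolic Rees algebra of $I$ is $R_s(I)=R\oplus I^{(1)}t\oplus\cdots\oplus I^{(k)}t^k\oplus\cdots\subset R[t]$, where the $k$-th symbolic power of $I$ is $I^{(k)}=\bigcap_{i}(I^kR_{\mathfrak{p}_i}\cap R)$, the intersection being over the minimal primes $\mathfrak{p}_i$ of $I$. A domain is normal if it is integrally closed in its field of fractions. *)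

theory Defs
  imports
    "HOL-Library.Poly_Mapping"
    "HOL-Computational_Algebra.Polynomial_Factorial"
begin

section \<open>The polynomial ring\<close>

text \<open>
  If \<open>'x\<close> has \<open>n\<close> elements, the type below is \<open>K[x\<^sub>1, \<dots>, x\<^sub>n]\<close>: a polynomial maps each
  exponent vector to its coefficient, and multiplication is convolution. The order on \<open>'x\<close> is
  irrelevant to the mathematics; the library's integral domain instance for
  \<^type>\<open>poly_mapping\<close> requires it.
\<close>

type_synonym ('x, 'k) mpoly = "('x \<Rightarrow>\<^sub>0 nat) \<Rightarrow>\<^sub>0 'k"

definition monomial :: "('x \<Rightarrow>\<^sub>0 nat) \<Rightarrow> ('x, 'k::comm_ring_1) mpoly" where
  "monomial m = Poly_Mapping.single m 1"


section \<open>Ideals\<close>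

text \<open>
  Ideals are the submodules of the ring viewed as a module over itself, so
  \<open>ideal.subspace I\<close> says that \<open>I\<close> is an ideal and \<open>ideal.span B\<close> is the ideal generated by \<open>B\<close>.
\<close>

interpretation ideal: module "(*) :: 'a::comm_ring_1 \<Rightarrow> 'a \<Rightarrow> 'a"
  by standard (simp_all add: algebra_simps)

definition monomial_ideal :: "('x, 'k::comm_ring_1) mpoly set \<Rightarrow> bool" where
  "monomial_ideal I \<longleftrightarrow> (\<exists>M. I = ideal.span (monomial ` M))"

definition prime_ideal :: "'a::comm_ring_1 set \<Rightarrow> bool" where
  "prime_ideal P \<longleftrightarrow> ideal.subspace P \<and> P \<noteq> UNIV \<and> (\<forall>a b. a * b \<in> P \<longrightarrow> a \<in> P \<or> b \<in> P)"

definition ideal_radical :: "'a::comm_ring_1 set \<Rightarrow> 'a set" where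
  "ideal_radical I = {a. \<exists>n. a ^ n \<in> I}"

definition primary_ideal :: "'a::comm_ring_1 set \<Rightarrow> bool" where
  "primary_ideal Q \<longleftrightarrow> ideal.subspace Q \<and> Q \<noteq> UNIV \<and>
     (\<forall>a b. a * b \<in> Q \<longrightarrow> a \<in> Q \<or> b \<in> ideal_radical Q)"

definition minimal_primes :: "'a::comm_ring_1 set \<Rightarrow> 'a set set" where
  "minimal_primes I =
     {P. prime_ideal P \<and> I \<subseteq> P \<and> (\<forall>Q. prime_ideal Q \<and> I \<subseteq> Q \<and> Q \<subseteq> P \<longrightarrow> Q = P)}"

text \<open>The primes that are annihilators of an element of \<open>R/I\<close>, i.e. of the form \<open>(I : f)\<close>.\<close>

definition associated_primes :: "'a::comm_ring_1 set \<Rightarrow> 'a set set" where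
  "associated_primes I = {P. prime_ideal P \<and> (\<exists>f. P = {g. g * f \<in> I})}"

definition embedded_primes :: "'a::comm_ring_1 set \<Rightarrow> 'a set set" where
  "embedded_primes I = associated_primes I - minimal_primes I"

text \<open>
  The components are \<open>Q 1, \<dots>, Q r\<close>. For \<open>r = 0\<close> the intersection is the whole ring.
\<close>

definition minimal_primary_decomposition ::
    "'a::comm_ring_1 set \<Rightarrow> nat \<Rightarrow> (nat \<Rightarrow> 'a set) \<Rightarrow> bool" where
  "minimal_primary_decomposition I r Q \<longleftrightarrow>
     (\<forall>i\<in>{1..r}. primary_ideal (Q i)) \<and>
     I = (\<Inter>i\<in>{1..r}. Q i) \<and>
     (\<forall>i\<in>{1..r}. I \<noteq> (\<Inter>j\<in>{1..r} - {i}. Q j)) \<and>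
     inj_on (\<lambda>i. ideal_radical (Q i)) {1..r}"

fun ideal_power :: "'a::comm_ring_1 set \<Rightarrow> nat \<Rightarrow> 'a set" where
  "ideal_power I 0 = UNIV"
| "ideal_power I (Suc k) = ideal.span {a * b | a b. a \<in> I \<and> b \<in> ideal_power I k}"


section \<open>Localization and symbolic powers\<close>

text \<open>
  The localization of a domain \<open>R\<close> at a prime, the ideals of the localization and their
  contractions to \<open>R\<close> are all formed inside the field of fractions of \<open>R\<close>.
\<close>

definition localization_at :: "'a::idom set \<Rightarrow> 'a fract set" where
  "localization_at P = {Fraction_Field.Fract a s | a s. s \<notin> P}"

definition extended_ideal :: "'a::idom set \<Rightarrow> 'a set \<Rightarrow> 'a fract set" where
  "extended_ideal J P =
     {\<Sum>a\<in>A. c a * to_fract a | A c. finite A \<and> A \<subseteq> J \<and> c ` A \<subseteq> localization_at P}"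

definition symbolic_power :: "'a::idom set \<Rightarrow> nat \<Rightarrow> 'a set" where
  "symbolic_power I k =
     (\<Inter>P\<in>minimal_primes I. to_fract -` extended_ideal (ideal_power I k) P)"


section \<open>Rees algebras\<close>

text \<open>Both are subsets of \<open>R[t]\<close>, the type of univariate polynomials over \<open>R\<close>.\<close>

definition rees_algebra :: "'a::idom set \<Rightarrow> 'a poly set" where
  "rees_algebra J = {p. \<forall>k\<ge>1. coeff p k \<in> ideal_power J k}"

definition symbolic_rees_algebra :: "'a::idom set \<Rightarrow> 'a poly set" where
  "symbolic_rees_algebra I = {p. \<forall>k\<ge>1. coeff p k \<in> symbolic_power I k}"


section \<open>Normality\<close>

text \<open>
  For a subring \<open>A\<close> of a domain \<open>D\<close>, the field of fractions of \<open>A\<close> is the subfield of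
  the field of fractions of \<open>D\<close> consisting of the quotients of elements of \<open>A\<close>.
\<close>

definition fraction_field :: "'a::idom set \<Rightarrow> 'a fract set" where
  "fraction_field A = {Fraction_Field.Fract a b | a b. a \<in> A \<and> b \<in> A \<and> b \<noteq> 0}"

definition integral_over :: "'a::idom set \<Rightarrow> 'a fract \<Rightarrow> bool" where
  "integral_over A x \<longleftrightarrow>
     (\<exists>f :: 'a fract poly. lead_coeff f = 1 \<and> (\<forall>i. coeff f i \<in> to_fract ` A) \<and> poly f x = 0)"

definition normal_domain :: "'a::idom set \<Rightarrow> bool" where
  "normal_domain A \<longleftrightarrow> (\<forall>x\<in>fraction_field A. integral_over A x \<longrightarrow> x \<in> to_fract ` A)"

end

theory Submission
  imports Defs
begin

text \<open>
  The theorem rests on the identity \<open>R\<^sub>s(I) = \<Inter>\<^sub>i R[Q\<^sub>i t]\<close> together with the fact that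
  \<open>R[Q\<^sub>i t]\<close> and \<open>R\<^sub>s(I)\<close> become equal once the complement of \<open>P\<^sub>i = rad Q\<^sub>i\<close> is inverted.

  Both come from the combinatorics of monomials. A monomial ideal is given by an upward closed set
  \<open>E\<close> of exponents, and each \<open>P\<^sub>i\<close> turns out to be generated by a set \<open>S\<close> of variables. Localizing
  at such a prime and contracting replaces \<open>E\<close> by the exponents that lie above some element of \<open>E\<close>
  in the coordinates from \<open>S\<close> (\<open>saturation_exponent_ideal\<close>). The point is that an element outside
  \<open>P\<^sub>i\<close> can be cancelled modulo an ideal of this form (\<open>cancel_outside_variable_prime\<close>). The
  operation on exponents commutes with powers, so if \<open>Q\<^sub>i\<close> is the contraction of \<open>I\<close>, then
  \<open>Q\<^sub>i\<^sup>k\<close> is the contraction of \<open>I\<^sup>k\<close>. Without embedded primes every \<open>P\<^sub>i\<close> is minimal, every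
  minimal prime is a \<open>P\<^sub>i\<close>, and \<open>Q\<^sub>i\<close> is indeed the contraction of \<open>I\<close> from the localization at
  \<open>P\<^sub>i\<close> (\<open>monomial_components\<close>). This gives \<open>I\<^sup>(\<^sup>k\<^sup>) = \<Inter>\<^sub>i Q\<^sub>i\<^sup>k\<close>.

  An intersection of normal subrings of \<open>R[t]\<close> is normal, provided that \<open>R[t]\<close> is normal; this
  proviso covers the empty intersection. Conversely, let \<open>x\<close> be a fraction integral over
  \<open>R[Q\<^sub>i t]\<close>. It lies in \<open>R[t]\<close> since \<open>R[t]\<close> is normal. A common multiplier \<open>s \<notin> P\<^sub>i\<close> moves all the
  elements of \<open>R[Q\<^sub>i t]\<close> that occur in a fraction for \<open>x\<close> and in an integral equation of \<open>x\<close> into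
  \<open>R\<^sub>s(I)\<close>, so \<open>s x\<close> is integral over \<open>R\<^sub>s(I)\<close>. Normality of \<open>R\<^sub>s(I)\<close> puts \<open>s x\<close> into
  \<open>R\<^sub>s(I) \<subseteq> R[Q\<^sub>i t]\<close>, and \<open>s\<close> cancels coefficientwise (\<open>normal_domain_descent\<close>).

  Normality of \<open>R[t]\<close> is obtained through complete integral closedness, which a division algorithm
  with respect to leading terms proves both for \<open>R\<close> and for \<open>R[t]\<close>.
\<close>

abbreviation keys :: "('a \<Rightarrow>\<^sub>0 'b::zero) \<Rightarrow> 'a set" where
  "keys \<equiv> Poly_Mapping.keys"

abbreviation lookup :: "('a \<Rightarrow>\<^sub>0 'b::zero) \<Rightarrow> 'a \<Rightarrow> 'b" where
  "lookup \<equiv> Poly_Mapping.lookup"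

text \<open>
  Viewing a ring as a module over itself turns re-association to the left into a simplification
  rule, which loops with the usual normalization of products.
\<close>

declare ideal.scale_scale [simp del]

section \<open>Ideals in a commutative ring\<close>

lemma subspace_add: "ideal.subspace J \<Longrightarrow> a \<in> J \<Longrightarrow> b \<in> J \<Longrightarrow> a + b \<in> J"
  by (rule ideal.subspace_add)

lemma subspace_mult: "ideal.subspace J \<Longrightarrow> a \<in> J \<Longrightarrow> c * a \<in> J"
  by (rule ideal.subspace_scale)

lemma subspace_one: "ideal.subspace J \<Longrightarrow> 1 \<in> J \<Longrightarrow> J = UNIV"
  using subspace_mult[of J 1] by auto

lemma subspace_ideal_power: "ideal.subspace (ideal_power I k)"
  by (cases k) (auto simp: ideal.subspace_span ideal.subspace_UNIV)

lemma prime_ideal_one: "prime_ideal P \<Longrightarrow> 1 \<notin> P"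
  using subspace_one by (auto simp: prime_ideal_def)

lemma prime_ideal_mult: "prime_ideal P \<Longrightarrow> a \<notin> P \<Longrightarrow> b \<notin> P \<Longrightarrow> a * b \<notin> P"
  by (auto simp: prime_ideal_def)

lemma prime_ideal_power: "prime_ideal P \<Longrightarrow> a \<notin> P \<Longrightarrow> a ^ n \<notin> P"
  by (induction n) (auto simp: prime_ideal_one prime_ideal_mult)

lemma prime_ideal_prod:
  assumes "prime_ideal P" "finite A" "\<And>x. x \<in> A \<Longrightarrow> f x \<notin> P"
  shows "prod f A \<notin> P"
  using assms(2,3)
  by (induction A rule: finite_induct)
    (auto simp: prime_ideal_one[OF assms(1)] prime_ideal_mult[OF assms(1)])

text \<open>
  The property \<open>T s x\<close> is meant to be ``multiplying \<open>x\<close> by \<open>s\<close> clears its denominator''; the product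
  of the individual multipliers works for all \<open>x\<close> and avoids \<open>P\<close> because \<open>P\<close> is prime.
\<close>

lemma common_multiplier:
  assumes "prime_ideal P" "finite X"
    and "\<And>x. x \<in> X \<Longrightarrow> \<exists>s. s \<notin> P \<and> T s x"
    and "\<And>s t x. T s x \<Longrightarrow> T (t * s) x"
  obtains s where "s \<notin> P" "\<And>x. x \<in> X \<Longrightarrow> T s x"
proof -
  have "\<exists>s. s \<notin> P \<and> (\<forall>x\<in>X. T s x)"
    using assms(2,3)
  proof (induction X rule: finite_induct)
    case empty
    then show ?case using prime_ideal_one[OF assms(1)] by auto
  next
    case (insert y X)
    then obtain s t where "s \<notin> P" "\<forall>x\<in>X. T s x" "t \<notin> P" "T t y"
      by (metis insertCI)
    then have "t * s \<notin> P" "\<forall>x\<in>insert y X. T (t * s) x"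
      using prime_ideal_mult[OF assms(1)] assms(4)[of s _ t] assms(4)[of t y s]
      by (auto simp: mult.commute[of s t])
    then show ?case by blast
  qed
  then show ?thesis using that by blast
qed

lemma power_split: "m \<le> n \<Longrightarrow> (a::'a::comm_monoid_mult) ^ n = a ^ (n - m) * a ^ m"
  by (metis le_add_diff_inverse2 power_add)

lemma subspace_radical:
  assumes "ideal.subspace J"
  shows "ideal.subspace (ideal_radical J)"
  unfolding ideal.subspace_def
proof (intro conjI allI ballI)
  have "(0::'a) ^ 1 \<in> J" using assms by (simp add: ideal.subspace_0)
  then show "0 \<in> ideal_radical J" unfolding ideal_radical_def by blast
next
  fix c a assume "a \<in> ideal_radical J"
  then obtain n where "a ^ n \<in> J" by (auto simp: ideal_radical_def)
  then have "(c * a) ^ n \<in> J" by (simp add: power_mult_distrib subspace_mult[OF assms])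
  then show "c * a \<in> ideal_radical J" by (auto simp: ideal_radical_def)
next
  fix a b assume "a \<in> ideal_radical J" "b \<in> ideal_radical J"
  then obtain m n where mn: "a ^ m \<in> J" "b ^ n \<in> J" by (auto simp: ideal_radical_def)
  have "(a + b) ^ (m + n) = (\<Sum>i\<le>m + n. of_nat (m + n choose i) * a ^ i * b ^ (m + n - i))"
    by (rule binomial_ring)
  also have "\<dots> \<in> J"
  proof (rule ideal.subspace_sum[OF assms])
    fix i assume i: "i \<in> {..m + n}"
    show "of_nat (m + n choose i) * a ^ i * b ^ (m + n - i) \<in> J"
    proof (cases "m \<le> i")
      case True
      then have "of_nat (m + n choose i) * a ^ i * b ^ (m + n - i) =
          (of_nat (m + n choose i) * b ^ (m + n - i) * a ^ (i - m)) * a ^ m"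
        by (subst power_split[of m i a]) (simp_all only: mult_ac)
      then show ?thesis by (simp only: subspace_mult[OF assms mn(1)])
    next
      case False
      then have eq: "b ^ (m + n - i) = b ^ (m - i) * b ^ n"
        using power_split[of n "m + n - i" b] by simp
      have "of_nat (m + n choose i) * a ^ i * b ^ (m + n - i) =
          (of_nat (m + n choose i) * a ^ i * b ^ (m - i)) * b ^ n"
        unfolding eq by (simp only: mult_ac)
      then show ?thesis by (simp only: subspace_mult[OF assms mn(2)])
    qed
  qed
  finally show "a + b \<in> ideal_radical J" by (auto simp: ideal_radical_def)
qed

lemma radical_superset: "J \<subseteq> ideal_radical J"
proof
  fix a assume "a \<in> J"
  then have "a ^ 1 \<in> J" by simp
  then show "a \<in> ideal_radical J" unfolding ideal_radical_def by blast
qed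

lemma prime_ideal_radical_primary:
  assumes "primary_ideal Q"
  shows "prime_ideal (ideal_radical Q)"
  unfolding prime_ideal_def
proof (intro conjI allI impI)
  have Q: "ideal.subspace Q" "Q \<noteq> UNIV" using assms by (auto simp: primary_ideal_def)
  show "ideal.subspace (ideal_radical Q)" by (rule subspace_radical[OF Q(1)])
  have "1 \<notin> Q" using Q subspace_one by auto
  then have "1 \<notin> ideal_radical Q" by (auto simp: ideal_radical_def)
  then show "ideal_radical Q \<noteq> UNIV" by auto
  fix a b assume "a * b \<in> ideal_radical Q"
  then obtain n where "a ^ n * b ^ n \<in> Q" by (auto simp: ideal_radical_def power_mult_distrib)
  then have "a ^ n \<in> Q \<or> b ^ n \<in> ideal_radical Q" using assms by (auto simp: primary_ideal_def)
  then show "a \<in> ideal_radical Q \<or> b \<in> ideal_radical Q"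
    by (auto simp: ideal_radical_def simp flip: power_mult)
qed

lemma primary_cancel:
  "primary_ideal Q \<Longrightarrow> s * a \<in> Q \<Longrightarrow> s \<notin> ideal_radical Q \<Longrightarrow> a \<in> Q"
  by (metis mult.commute primary_ideal_def)

lemma radical_subset_prime:
  assumes "prime_ideal P" "J \<subseteq> P"
  shows "ideal_radical J \<subseteq> P"
  using prime_ideal_power[OF assms(1)] assms(2) by (auto simp: ideal_radical_def)

section \<open>Contraction of extended ideals\<close>

text \<open>
  For a prime ideal \<open>P\<close> of a domain \<open>R\<close> this is \<open>J R\<^sub>P \<inter> R\<close>, described without fractions.
\<close>

definition saturation :: "'a::comm_ring_1 set \<Rightarrow> 'a set \<Rightarrow> 'a set" where
  "saturation P J = {a. \<exists>s. s \<notin> P \<and> s * a \<in> J}"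

lemma subspace_saturation:
  assumes "prime_ideal P" "ideal.subspace J"
  shows "ideal.subspace (saturation P J)"
  unfolding ideal.subspace_def
proof (intro conjI allI ballI)
  show "0 \<in> saturation P J"
    using prime_ideal_one[OF assms(1)] ideal.subspace_0[OF assms(2)] by (auto simp: saturation_def)
next
  fix c a assume "a \<in> saturation P J"
  then obtain s where "s \<notin> P" "s * a \<in> J" by (auto simp: saturation_def)
  then show "c * a \<in> saturation P J"
    using subspace_mult[OF assms(2), of "s * a" c] by (auto simp: saturation_def mult_ac)
next
  fix a b assume "a \<in> saturation P J" "b \<in> saturation P J"
  then obtain s t where "s \<notin> P" "s * a \<in> J" "t \<notin> P" "t * b \<in> J" by (auto simp: saturation_def)
  moreover from this have "t * (s * a) + s * (t * b) \<in> J"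
    using assms(2) by (simp add: subspace_add subspace_mult)
  moreover have "t * (s * a) + s * (t * b) = (s * t) * (a + b)" by (simp add: algebra_simps)
  ultimately show "a + b \<in> saturation P J"
    using prime_ideal_mult[OF assms(1), of s t] by (auto simp: saturation_def)
qed

lemma saturation_superset: "prime_ideal P \<Longrightarrow> J \<subseteq> saturation P J"
  using prime_ideal_one by (fastforce simp: saturation_def)

text \<open>
  An element of \<open>J R\<^sub>P\<close> is a finite sum of fractions times elements of \<open>J\<close>, so the product of the
  denominators, which lies outside \<open>P\<close>, multiplies it into \<open>J\<close>.
\<close>

lemma contraction_extended_ideal:
  assumes P: "prime_ideal P" and J: "ideal.subspace J"
  shows "to_fract -` extended_ideal J P = saturation P J"
proof (intro set_eqI iffI)
  fix a assume "a \<in> saturation P J"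
  then obtain s where s: "s \<notin> P" "s * a \<in> J" by (auto simp: saturation_def)
  then have "s \<noteq> 0" using P by (auto simp: prime_ideal_def ideal.subspace_0)
  then have "to_fract a = (\<Sum>x\<in>{s * a}. Fraction_Field.Fract 1 s * to_fract x)"
    by (simp add: Fract_conv_to_fract)
  moreover have "(\<lambda>_. Fraction_Field.Fract 1 s) ` {s * a} \<subseteq> localization_at P"
    using s by (auto simp: localization_at_def)
  ultimately have "to_fract a \<in> extended_ideal J P"
    unfolding extended_ideal_def using s
    by (intro CollectI exI[of _ "{s * a}"] exI[of _ "\<lambda>_. Fraction_Field.Fract 1 s"]) auto
  then show "a \<in> to_fract -` extended_ideal J P" by simp
next
  fix a assume "a \<in> to_fract -` extended_ideal J P"
  then obtain A c where A: "to_fract a = (\<Sum>x\<in>A. c x * to_fract x)" "finite A" "A \<subseteq> J"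
      "c ` A \<subseteq> localization_at P"
    by (auto simp: extended_ideal_def)
  have "\<exists>s. s \<notin> P \<and> (\<exists>b\<in>J. to_fract s * (\<Sum>x\<in>A. c x * to_fract x) = to_fract b)"
    using A(2-)
  proof (induction A rule: finite_induct)
    case empty
    then show ?case using prime_ideal_one[OF P] ideal.subspace_0[OF J] by auto
  next
    case (insert y A)
    then obtain s b where s: "s \<notin> P" "b \<in> J"
        "to_fract s * (\<Sum>x\<in>A. c x * to_fract x) = to_fract b" by auto
    obtain m t where t: "c y = Fraction_Field.Fract m t" "t \<notin> P"
      using insert.prems by (auto simp: localization_at_def)
    have "t \<noteq> 0" using P t by (auto simp: prime_ideal_def ideal.subspace_0)
    then have cy: "to_fract t * c y = to_fract m" using t by (simp add: Fract_conv_to_fract)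
    define z where "z = (\<Sum>x\<in>A. c x * to_fract x)"
    have "to_fract (s * t) * (\<Sum>x\<in>insert y A. c x * to_fract x) =
        to_fract s * to_fract t * (c y * to_fract y + z)"
      using insert.hyps by (simp add: z_def)
    also have "\<dots> = to_fract t * (to_fract s * z) + to_fract s * (to_fract t * c y) * to_fract y"
      by (simp only: distrib_left mult_ac add.commute)
    also have "\<dots> = to_fract (t * b + s * m * y)"
      unfolding cy s(3)[folded z_def] by simp
    finally show ?case
      using prime_ideal_mult[OF P s(1) t(2)] J s(2) insert.prems
      by (intro exI[of _ "s * t"] conjI bexI[of _ "t * b + s * m * y"])
         (auto intro!: subspace_add subspace_mult)
  qed
  then obtain s b where "s \<notin> P" "b \<in> J" "to_fract s * to_fract a = to_fract b"
    using A(1) by auto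
  then have "s \<notin> P" "s * a \<in> J"
    by (auto simp flip: to_fract_mult)
  then show "a \<in> saturation P J" by (auto simp: saturation_def)
qed

lemma symbolic_power_eq_saturation:
  "symbolic_power I k = (\<Inter>P\<in>minimal_primes I. saturation P (ideal_power I k))"
  unfolding symbolic_power_def
  by (intro INF_cong refl contraction_extended_ideal subspace_ideal_power)
     (auto simp: minimal_primes_def)

section \<open>Products of polynomials with a distinguished term\<close>

text \<open>
  No cancellation can occur at an exponent that is reached by only one pair of terms. Extremal terms
  with respect to various orders provide such pairs.
\<close>

lemma lookup_mult_unique:
  fixes f g :: "'a::monoid_add \<Rightarrow>\<^sub>0 'b::semiring_0"
  assumes "\<And>m n. m \<in> keys f \<Longrightarrow> n \<in> keys g \<Longrightarrow> m + n = m0 + n0 \<Longrightarrow> m = m0 \<and> n = n0"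
  shows "lookup (f * g) (m0 + n0) = lookup f m0 * lookup g n0"
proof -
  have eq: "lookup f l * (\<Sum>q. lookup g q when m0 + n0 = l + q) =
      (lookup f m0 * lookup g n0 when l = m0)" for l
  proof (cases "l \<in> keys f")
    case False
    then show ?thesis by (auto simp: when_def in_keys_iff)
  next
    case True
    have "(lookup g q when m0 + n0 = l + q) = ((lookup g n0 when l = m0) when q = n0)" for q
      using assms[OF True, of q] unfolding when_def by (metis in_keys_iff)
    then show ?thesis by (simp only: Sum_any_when_equal) (simp add: when_def)
  qed
  show ?thesis unfolding lookup_mult eq by simp
qed

lemma keys_mult_obtain:
  assumes "k \<in> keys (f * g)"
  obtains m n where "m \<in> keys f" "n \<in> keys g" "k = m + n"
  using keys_mult[of f g] assms by auto

section \<open>Monomial ideals and exponent sets\<close>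

definition up_closed :: "('x \<Rightarrow>\<^sub>0 nat) set \<Rightarrow> bool" where
  "up_closed E \<longleftrightarrow> (\<forall>m\<in>E. \<forall>n. m + n \<in> E)"

definition exponent_ideal :: "('x \<Rightarrow>\<^sub>0 nat) set \<Rightarrow> ('x, 'k::comm_ring_1) mpoly set" where
  "exponent_ideal E = {f. keys f \<subseteq> E}"

lemma keys_monomial [simp]: "keys (monomial m :: ('x, 'k::comm_ring_1) mpoly) = {m}"
  by (simp add: monomial_def)

lemma monomial_add: "monomial (m + n) = monomial m * monomial n"
  by (simp add: monomial_def mult_single)

lemma subspace_exponent_ideal:
  assumes "up_closed E"
  shows "ideal.subspace (exponent_ideal E)"
  unfolding ideal.subspace_def
proof (intro conjI allI ballI)
  show "0 \<in> exponent_ideal E" by (simp add: exponent_ideal_def)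
next
  fix f g :: "('a, 'b) mpoly" assume "f \<in> exponent_ideal E" "g \<in> exponent_ideal E"
  then show "f + g \<in> exponent_ideal E" using keys_add[of f g] by (auto simp: exponent_ideal_def)
next
  fix c f :: "('a, 'b) mpoly" assume "f \<in> exponent_ideal E"
  then show "c * f \<in> exponent_ideal E"
    using assms keys_mult[of c f] by (fastforce simp: exponent_ideal_def up_closed_def add.commute)
qed

text \<open>
  This reduces inclusions of monomial ideals to monomials, for which divisibility is a comparison of
  exponents.
\<close>

lemma mem_subspace_monomials:
  fixes f :: "('x, 'k::comm_ring_1) mpoly"
  assumes "ideal.subspace J" "\<And>m. m \<in> keys f \<Longrightarrow> monomial m \<in> J"
  shows "f \<in> J"
proof -
  have "f = (\<Sum>m\<in>keys f. Poly_Mapping.single m (lookup f m))"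
    by (rule poly_mapping_eqI)
       (auto simp: lookup_sum lookup_single when_def in_keys_iff sum.delta)
  also have "\<dots> = (\<Sum>m\<in>keys f. Poly_Mapping.single 0 (lookup f m) * monomial m)"
    by (simp add: monomial_def mult_single)
  also have "\<dots> \<in> J"
    by (intro ideal.subspace_sum subspace_mult assms)
  finally show ?thesis .
qed

lemma exponent_ideal_subset:
  fixes J :: "('x, 'k::comm_ring_1) mpoly set"
  assumes "ideal.subspace J" "\<And>m. m \<in> E \<Longrightarrow> monomial m \<in> J"
  shows "exponent_ideal E \<subseteq> J"
  using mem_subspace_monomials[OF assms(1)] assms(2) by (auto simp: exponent_ideal_def)

lemma monomial_ideal_exponents:
  fixes I :: "('x, 'k::comm_ring_1) mpoly set"
  assumes "monomial_ideal I"
  obtains E where "up_closed E" "I = exponent_ideal E"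
proof -
  obtain M where M: "I = ideal.span (monomial ` M)" using assms by (auto simp: monomial_ideal_def)
  define E where "E = {m + n | m n. m \<in> M}"
  have E: "up_closed E" unfolding up_closed_def E_def
    by (auto simp: add.assoc) (metis (no_types))
  have "monomial ` M \<subseteq> (exponent_ideal E :: ('x, 'k) mpoly set)"
    unfolding exponent_ideal_def E_def by auto (metis add.right_neutral)
  then have "I \<subseteq> exponent_ideal E"
    unfolding M by (rule ideal.span_minimal) (rule subspace_exponent_ideal[OF E])
  moreover have "exponent_ideal E \<subseteq> I"
  proof (rule exponent_ideal_subset)
    show "ideal.subspace I" by (simp add: M ideal.subspace_span)
    fix m assume "m \<in> E"
    then obtain a b where ab: "m = b + a" "a \<in> M" by (auto simp: E_def add.commute)
    show "monomial m \<in> I"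
      unfolding M ab(1) monomial_add
      by (intro ideal.span_scale ideal.span_base imageI ab(2))
  qed
  ultimately show ?thesis using that E by blast
qed

text \<open>
  The \<open>k\<close>-fold Minkowski sum, the exponent set of the \<open>k\<close>-th power. It is everything for \<open>k = 0\<close>, as
  the exponent set of the unit ideal.
\<close>

fun multiple_sum :: "('x \<Rightarrow>\<^sub>0 nat) set \<Rightarrow> nat \<Rightarrow> ('x \<Rightarrow>\<^sub>0 nat) set" where
  "multiple_sum E 0 = UNIV"
| "multiple_sum E (Suc k) = {m + n | m n. m \<in> E \<and> n \<in> multiple_sum E k}"

lemma up_closed_multiple_sum: "up_closed (multiple_sum E k)"
proof (induction k)
  case (Suc k)
  show ?case unfolding up_closed_def
  proof (intro ballI allI)
    fix l n assume "l \<in> multiple_sum E (Suc k)"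
    then obtain a b where "l = a + b" "a \<in> E" "b \<in> multiple_sum E k" by auto
    then show "l + n \<in> multiple_sum E (Suc k)" using Suc
      by (auto simp: up_closed_def add.assoc)
  qed
qed (simp add: up_closed_def)

lemma ideal_power_exponent_ideal:
  assumes "up_closed E"
  shows "ideal_power (exponent_ideal E) k = (exponent_ideal (multiple_sum E k) :: ('x, 'k::comm_ring_1) mpoly set)"
proof (induction k)
  case 0
  then show ?case by (simp add: exponent_ideal_def)
next
  case (Suc k)
  let ?B = "{a * b | a b. a \<in> exponent_ideal E \<and> b \<in> exponent_ideal (multiple_sum E k)} :: ('x, 'k) mpoly set"
  have "?B \<subseteq> exponent_ideal (multiple_sum E (Suc k))"
    by (auto simp: exponent_ideal_def elim!: keys_mult_obtain)
  then have 1: "ideal.span ?B \<subseteq> exponent_ideal (multiple_sum E (Suc k))"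
    by (rule ideal.span_minimal) (rule subspace_exponent_ideal[OF up_closed_multiple_sum])
  have 2: "exponent_ideal (multiple_sum E (Suc k)) \<subseteq> ideal.span ?B"
  proof (rule exponent_ideal_subset[OF ideal.subspace_span])
    fix m assume "m \<in> multiple_sum E (Suc k)"
    then obtain a b where "m = a + b" "a \<in> E" "b \<in> multiple_sum E k" by auto
    then have "(monomial m :: ('x, 'k) mpoly) \<in> ?B"
      unfolding exponent_ideal_def
      by (intro CollectI exI[of _ "monomial a"] exI[of _ "monomial b"]) (simp add: monomial_add)
    then show "monomial m \<in> ideal.span ?B" by (rule ideal.span_base)
  qed
  show ?case using 1 2 Suc by simp
qed

section \<open>Localization of a monomial ideal at a prime generated by variables\<close>

text \<open>
  Inverting the variables outside \<open>S\<close> makes their exponents irrelevant: what remains of \<open>E\<close> is its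
  shadow in the coordinates from \<open>S\<close>.
\<close>

definition local_exponents :: "'x set \<Rightarrow> ('x \<Rightarrow>\<^sub>0 nat) set \<Rightarrow> ('x \<Rightarrow>\<^sub>0 nat) set" where
  "local_exponents S E = {m. \<exists>e\<in>E. \<forall>j\<in>S. lookup e j \<le> lookup m j}"

lemma local_exponents_superset: "E \<subseteq> local_exponents S E"
  by (auto simp: local_exponents_def)

lemma up_closed_local_exponents: "up_closed (local_exponents S E)"
  by (fastforce simp: up_closed_def local_exponents_def lookup_add intro: trans_le_add1)

text \<open>
  The monomial with exponent \<open>n\<close> involves only variables outside \<open>S\<close>, so it is a unit in the
  localization; it is chosen as the part of some \<open>e \<in> E\<close> that exceeds \<open>m\<close>.
\<close>

lemma local_exponents_multiplier:
  assumes "up_closed E" "m \<in> local_exponents S E"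
  obtains n where "\<forall>j\<in>S. lookup n j = 0" "n + m \<in> E"
proof -
  obtain e where e: "e \<in> E" "\<forall>j\<in>S. lookup e j \<le> lookup m j"
    using assms(2) by (auto simp: local_exponents_def)
  have "(e - m) + m = e + (m - e)"
    by (rule poly_mapping_eqI) (simp add: lookup_add lookup_minus)
  then have "(e - m) + m \<in> E" using e assms(1) by (simp add: up_closed_def)
  moreover have "\<forall>j\<in>S. lookup (e - m) j = 0" using e by (simp add: lookup_minus)
  ultimately show ?thesis using that by blast
qed

text \<open>
  Contraction from the localization commutes with powers. The nontrivial inclusion splits an exponent
  that dominates \<open>e + f\<close> on \<open>S\<close> into a summand that dominates \<open>e\<close> and one that dominates \<open>f\<close>.
\<close>

lemma local_exponents_multiple_sum:
  "local_exponents S (multiple_sum E k) = multiple_sum (local_exponents S E) k"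
proof (induction k)
  case 0
  then show ?case by (auto simp: local_exponents_def)
next
  case (Suc k)
  show ?case
  proof (intro set_eqI iffI)
    fix m assume "m \<in> local_exponents S (multiple_sum E (Suc k))"
    then obtain e f where ef: "e \<in> E" "f \<in> multiple_sum E k" "\<forall>j\<in>S. lookup (e + f) j \<le> lookup m j"
      by (auto simp: local_exponents_def)
    \<comment> \<open>Subtraction truncates, so \<open>a\<close> is the minimum of \<open>m\<close> and \<open>e\<close> in each coordinate.\<close>
    define b where "b = m - e"
    define a where "a = m - b"
    have "m = a + b"
      by (rule poly_mapping_eqI) (simp add: a_def b_def lookup_add lookup_minus)
    moreover have "a \<in> local_exponents S E"
      unfolding local_exponents_def
      by (intro CollectI bexI[OF _ ef(1)] ballI)
         (use ef(3) in \<open>fastforce simp: a_def b_def lookup_add lookup_minus\<close>)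
    moreover have "b \<in> local_exponents S (multiple_sum E k)"
      unfolding local_exponents_def
      by (intro CollectI bexI[OF _ ef(2)] ballI)
         (use ef(3) in \<open>fastforce simp: a_def b_def lookup_add lookup_minus\<close>)
    ultimately show "m \<in> multiple_sum (local_exponents S E) (Suc k)" using Suc by auto
  next
    fix m assume "m \<in> multiple_sum (local_exponents S E) (Suc k)"
    then obtain a b where ab: "m = a + b" "a \<in> local_exponents S E"
        "b \<in> local_exponents S (multiple_sum E k)" using Suc by auto
    then obtain e f where "e \<in> E" "f \<in> multiple_sum E k" "\<forall>j\<in>S. lookup e j \<le> lookup a j"
        "\<forall>j\<in>S. lookup f j \<le> lookup b j" by (auto simp: local_exponents_def)
    then have "e + f \<in> multiple_sum E (Suc k)" "\<forall>j\<in>S. lookup (e + f) j \<le> lookup m j"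
      using ab(1) by (auto simp: lookup_add intro: add_mono)
    then show "m \<in> local_exponents S (multiple_sum E (Suc k))"
      unfolding local_exponents_def by blast
  qed
qed

definition variable_prime :: "'x set \<Rightarrow> ('x, 'k::comm_ring_1) mpoly set" where
  "variable_prime S = exponent_ideal {m. \<exists>j\<in>S. lookup m j \<noteq> 0}"

lemma variables_up_closed: "up_closed {m. \<exists>j\<in>S. lookup m j \<noteq> 0}"
  by (auto simp: up_closed_def lookup_add)

text \<open>
  Elements outside \<open>P = (x\<^sub>j : j \<in> S)\<close> are nonzerodivisors modulo an ideal whose exponent set depends
  only on the coordinates from \<open>S\<close>. Since \<open>s \<notin> P\<close>, it has a term of degree \<open>0\<close> in the variables from
  \<open>S\<close>. If \<open>a\<close> had terms with exponents outside \<open>F\<close>, take among these one of least degree in \<open>S\<close>,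
  breaking ties with the monomial order, and the least term of \<open>s\<close> of degree \<open>0\<close> in \<open>S\<close>. No other
  pair of terms yields the sum of their exponents, so that sum is an exponent of \<open>s a\<close>, although it
  is not in \<open>F\<close>.
\<close>

lemma cancel_outside_variable_prime:
  fixes s a :: "('x::{finite,linorder}, 'k::idom) mpoly"
  assumes F: "up_closed F" "\<And>m n. m + n \<in> F \<Longrightarrow> \<forall>j\<in>S. lookup n j = 0 \<Longrightarrow> m \<in> F"
    and s: "s \<notin> variable_prime S" and sa: "s * a \<in> exponent_ideal F"
  shows "a \<in> exponent_ideal F"
proof (rule ccontr)
  define deg where "deg = (\<lambda>m::'x \<Rightarrow>\<^sub>0 nat. \<Sum>j\<in>S. lookup m j)"
  have deg_add: "deg (m + n) = deg m + deg n" for m n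
    by (simp add: deg_def lookup_add sum.distrib)
  have deg_0: "deg m = 0 \<longleftrightarrow> (\<forall>j\<in>S. lookup m j = 0)" for m
    by (simp add: deg_def)
  assume "a \<notin> exponent_ideal F"
  define A where "A = keys a - F"
  have A: "finite A" "A \<noteq> {}"
    using \<open>a \<notin> exponent_ideal F\<close> by (auto simp: A_def exponent_ideal_def)
  define A0 where "A0 = {m\<in>A. deg m = Min (deg ` A)}"
  have "Min (deg ` A) \<in> deg ` A" using A by (intro Min_in) auto
  then obtain m1 where "m1 \<in> A0" by (auto simp: A0_def)
  then have A0: "finite A0" "A0 \<noteq> {}" using A by (auto simp: A0_def)
  define B0 where "B0 = {m\<in>keys s. deg m = 0}"
  have B0: "finite B0" "B0 \<noteq> {}"
    using s by (auto simp: B0_def deg_0 variable_prime_def exponent_ideal_def)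
  define m0 where "m0 = Min A0"
  define n0 where "n0 = Min B0"
  have m0: "m0 \<in> A0" and n0: "n0 \<in> B0"
    using A0 B0 by (auto simp: m0_def n0_def intro: Min_in)
  have m0F: "n0 + m0 \<notin> F"
    using F(2)[of m0 n0] m0 n0 by (auto simp: A0_def A_def B0_def deg_0 add.commute)
  have "lookup (s * a) (n0 + m0) = lookup s n0 * lookup a m0"
  proof (rule lookup_mult_unique)
    fix n m assume nm: "n \<in> keys s" "m \<in> keys a" "n + m = n0 + m0"
    have "m \<notin> F" using F(1) m0F nm(3) by (metis add.commute up_closed_def)
    then have mA: "m \<in> A" using nm by (simp add: A_def)
    then have "deg m \<ge> deg m0" using A m0 by (auto simp: A0_def)
    moreover have "deg (n + m) = deg (n0 + m0)" using nm(3) by simp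
    then have "deg n + deg m = deg m0" using n0 by (simp add: deg_add B0_def)
    ultimately have d: "deg n = 0" "deg m = deg m0" by auto
    then have "m \<in> A0" "n \<in> B0" using mA nm m0 by (auto simp: A0_def B0_def)
    then have le: "m0 \<le> m" "n0 \<le> n" using A0 B0 by (auto simp: m0_def n0_def)
    have "\<not> n0 < n"
    proof
      assume "n0 < n"
      then show False using add_less_le_mono[OF _ le(1), of n0 n] nm(3) by simp
    qed
    then have "n = n0" using le(2) by (metis order.order_iff_strict)
    then show "n = n0 \<and> m = m0" using nm(3) by auto
  qed
  also have "\<dots> \<noteq> 0" using m0 n0 by (auto simp: A0_def B0_def A_def in_keys_iff)
  finally have "n0 + m0 \<in> keys (s * a)" by (simp add: in_keys_iff)
  then show False using sa m0F by (auto simp: exponent_ideal_def)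
qed

lemma local_exponents_cancel:
  assumes "m + n \<in> local_exponents S E" "\<forall>j\<in>S. lookup n j = 0"
  shows "m \<in> local_exponents S E"
  using assms by (auto simp: local_exponents_def lookup_add)

text \<open>
  Primality is the cancellation law applied to the ideal itself.
\<close>

lemma prime_variable_prime:
  "prime_ideal (variable_prime S :: ('x::{finite,linorder}, 'k::idom) mpoly set)"
  unfolding prime_ideal_def
proof (intro conjI allI impI)
  show "ideal.subspace (variable_prime S :: ('x, 'k) mpoly set)"
    unfolding variable_prime_def by (rule subspace_exponent_ideal[OF variables_up_closed])
  have "(1 :: ('x, 'k) mpoly) \<notin> variable_prime S" by (simp add: variable_prime_def exponent_ideal_def)
  then show "(variable_prime S :: ('x, 'k) mpoly set) \<noteq> UNIV" by auto
  fix a b :: "('x, 'k) mpoly" assume "a * b \<in> variable_prime S"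
  moreover have "b \<in> variable_prime S" if "a \<notin> variable_prime S" "a * b \<in> variable_prime S"
    using that unfolding variable_prime_def
    by (intro cancel_outside_variable_prime[of "{m. \<exists>j\<in>S. lookup m j \<noteq> 0}" S a b, OF variables_up_closed])
       (auto simp: lookup_add variable_prime_def)
  ultimately show "a \<in> variable_prime S \<or> b \<in> variable_prime S" by blast
qed

lemma saturation_exponent_ideal:
  assumes "up_closed E"
  shows "saturation (variable_prime S) (exponent_ideal E) =
    (exponent_ideal (local_exponents S E) :: ('x::{finite,linorder}, 'k::idom) mpoly set)"
proof
  show "saturation (variable_prime S) (exponent_ideal E) \<subseteq>
    (exponent_ideal (local_exponents S E) :: ('x, 'k) mpoly set)"
  proof
    fix a :: "('x, 'k) mpoly" assume "a \<in> saturation (variable_prime S) (exponent_ideal E)"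
    then obtain s where "s \<notin> variable_prime S" "s * a \<in> exponent_ideal E"
      by (auto simp: saturation_def)
    then show "a \<in> exponent_ideal (local_exponents S E)"
      using local_exponents_superset[of E S]
      by (intro cancel_outside_variable_prime[of "local_exponents S E" S s a] up_closed_local_exponents)
         (rule local_exponents_cancel, auto simp: exponent_ideal_def)
  qed
  show "(exponent_ideal (local_exponents S E) :: ('x, 'k) mpoly set) \<subseteq>
    saturation (variable_prime S) (exponent_ideal E)"
  proof (rule exponent_ideal_subset)
    show "ideal.subspace (saturation (variable_prime S) (exponent_ideal E) :: ('x, 'k) mpoly set)"
      by (intro subspace_saturation prime_variable_prime subspace_exponent_ideal assms)
    fix m assume "m \<in> local_exponents S E"
    then obtain n where "\<forall>j\<in>S. lookup n j = 0" "n + m \<in> E"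
      using local_exponents_multiplier[OF assms] by blast
    then show "(monomial m :: ('x, 'k) mpoly) \<in> saturation (variable_prime S) (exponent_ideal E)"
      unfolding saturation_def
      by (intro CollectI exI[of _ "monomial n"])
         (auto simp: variable_prime_def exponent_ideal_def simp flip: monomial_add)
  qed
qed

lemma saturation_ideal_power:
  fixes E :: "('x::{finite,linorder} \<Rightarrow>\<^sub>0 nat) set"
  assumes "up_closed E"
  shows "saturation (variable_prime S) (ideal_power (exponent_ideal E :: ('x, 'k::idom) mpoly set) k) =
    ideal_power (exponent_ideal (local_exponents S E)) k"
  unfolding ideal_power_exponent_ideal[OF assms] ideal_power_exponent_ideal[OF up_closed_local_exponents]
    saturation_exponent_ideal[OF up_closed_multiple_sum] local_exponents_multiple_sum ..

section \<open>The primary components of a monomial ideal without embedded primes\<close>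

lemma monomial_in_prime:
  fixes P :: "('x::{finite,linorder}, 'k::idom) mpoly set"
  assumes "prime_ideal P" "monomial n \<in> P"
  shows "\<exists>j. lookup n j \<noteq> 0 \<and> monomial (Poly_Mapping.single j 1) \<in> P"
  using assms(2)
proof (induction "\<Sum>j\<in>UNIV. lookup n j" arbitrary: n rule: less_induct)
  case less
  show ?case
  proof (cases "n = 0")
    case True
    then have "1 \<in> P" using less.prems by (simp add: monomial_def)
    then show ?thesis using prime_ideal_one[OF assms(1)] by simp
  next
    case False
    then obtain j where j: "lookup n j \<noteq> 0" by (metis lookup_zero poly_mapping_eqI)
    let ?n = "n - Poly_Mapping.single j 1"
    have n: "n = Poly_Mapping.single j 1 + ?n"
      using j by (intro poly_mapping_eqI) (auto simp: lookup_add lookup_minus lookup_single when_def)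
    have "(\<Sum>i\<in>UNIV. lookup ?n i) < (\<Sum>i\<in>UNIV. lookup n i)"
      using j by (intro sum_strict_mono_ex1) (auto simp: lookup_minus intro!: exI[of _ j])
    moreover have "(monomial (Poly_Mapping.single j 1) :: ('x, 'k) mpoly) \<in> P \<or> monomial ?n \<in> P"
      using less.prems assms(1) monomial_add[of "Poly_Mapping.single j 1" ?n] n
      by (metis prime_ideal_mult)
    moreover have "lookup n i \<noteq> 0" if "lookup ?n i \<noteq> 0" for i
      using that by (simp add: lookup_minus)
    ultimately show ?thesis
      using less.hyps[of ?n] j by blast
  qed
qed

lemma variable_prime_subset:
  fixes J :: "('x, 'k::comm_ring_1) mpoly set"
  assumes "ideal.subspace J" "\<And>j. j \<in> S \<Longrightarrow> monomial (Poly_Mapping.single j 1) \<in> J"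
  shows "variable_prime S \<subseteq> J"
  unfolding variable_prime_def
proof (rule exponent_ideal_subset[OF assms(1)])
  fix m :: "'x \<Rightarrow>\<^sub>0 nat" assume "m \<in> {m. \<exists>j\<in>S. lookup m j \<noteq> 0}"
  then obtain j where j: "j \<in> S" "lookup m j \<noteq> 0" by auto
  have "m = (m - Poly_Mapping.single j 1) + Poly_Mapping.single j 1"
    using j by (intro poly_mapping_eqI) (auto simp: lookup_add lookup_minus lookup_single when_def)
  then show "monomial m \<in> J"
    using subspace_mult[OF assms(1) assms(2)[OF j(1)]] by (metis monomial_add)
qed

text \<open>
  Here \<open>A\<close> is the intersection of the remaining components, and \<open>f\<close> witnesses that \<open>Q\<close> is not
  redundant; \<open>Q\<close> itself need not be a monomial ideal. Let \<open>S\<close> be the set of variables in the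
  radical. A monomial in the other variables can be cancelled modulo the primary ideal \<open>Q\<close>, so \<open>Q\<close>
  contains the contraction of the monomial ideal from the localization at \<open>(x\<^sub>j : j \<in> S)\<close>. If some
  \<open>p\<close> in the radical were outside \<open>(x\<^sub>j : j \<in> S)\<close>, then \<open>p\<^sup>k f \<in> Q \<inter> A\<close> would put \<open>f\<close> into that
  contraction and thus into \<open>Q\<close>.
\<close>

lemma radical_of_component:
  fixes Q :: "('x::{finite,linorder}, 'k::idom) mpoly set"
  assumes E: "up_closed E" and Q: "primary_ideal Q" and A: "ideal.subspace A"
    and QA: "exponent_ideal E = Q \<inter> A" and f: "f \<in> A" "f \<notin> Q"
  obtains S where "ideal_radical Q = variable_prime S"
proof -
  define S where "S = {j. (monomial (Poly_Mapping.single j 1) :: ('x, 'k) mpoly) \<in> ideal_radical Q}"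
  have sub: "ideal.subspace Q" using Q by (simp add: primary_ideal_def)
  have pr: "prime_ideal (ideal_radical Q)" by (rule prime_ideal_radical_primary[OF Q])
  have 1: "exponent_ideal (local_exponents S E) \<subseteq> Q"
  proof (rule exponent_ideal_subset[OF sub])
    fix m assume "m \<in> local_exponents S E"
    then obtain n where n: "\<forall>j\<in>S. lookup n j = 0" "n + m \<in> E"
      using local_exponents_multiplier[OF E] by blast
    then have "(monomial n * monomial m :: ('x, 'k) mpoly) \<in> exponent_ideal E"
      by (simp add: exponent_ideal_def flip: monomial_add)
    then have "(monomial n * monomial m :: ('x, 'k) mpoly) \<in> Q" using QA by blast
    moreover have "(monomial n :: ('x, 'k) mpoly) \<notin> ideal_radical Q"
      using monomial_in_prime[OF pr, of n] n(1) by (auto simp: S_def)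
    ultimately show "monomial m \<in> Q" using primary_cancel[OF Q] by blast
  qed
  have 2: "variable_prime S \<subseteq> ideal_radical Q"
    using pr by (intro variable_prime_subset) (auto simp: S_def prime_ideal_def)
  have 3: "ideal_radical Q \<subseteq> variable_prime S"
  proof (rule ccontr)
    assume "\<not> ideal_radical Q \<subseteq> variable_prime S"
    then obtain p k where p: "p \<notin> variable_prime S" "p ^ k \<in> Q" by (auto simp: ideal_radical_def)
    have "p ^ k * f \<in> Q" using subspace_mult[OF sub p(2), of f] by (simp add: mult.commute)
    moreover have "p ^ k * f \<in> A" using subspace_mult[OF A f(1)] .
    ultimately have "p ^ k * f \<in> exponent_ideal E" using QA by blast
    then have "f \<in> saturation (variable_prime S) (exponent_ideal E)"
      using prime_ideal_power[OF prime_variable_prime p(1)] by (auto simp: saturation_def)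
    then show False using 1 f(2) saturation_exponent_ideal[OF E] by blast
  qed
  show ?thesis using that 2 3 by blast
qed

text \<open>
  Starting from \<open>f\<close>, each \<open>x \<in> X\<close> in turn is dealt with by multiplying with the highest power of \<open>x\<close>
  that does not lead into \<open>Q\<close>.
\<close>

lemma annihilated_by_radical:
  assumes Q: "ideal.subspace Q" and A: "ideal.subspace A" and f: "f \<in> A" "f \<notin> Q"
    and X: "finite X" "X \<subseteq> ideal_radical Q"
  shows "\<exists>g. g \<in> A \<and> g \<notin> Q \<and> (\<forall>x\<in>X. x * g \<in> Q)"
  using X
proof (induction X rule: finite_induct)
  case empty
  then show ?case using f by auto
next
  case (insert x X)
  then obtain g where g: "g \<in> A" "g \<notin> Q" "\<forall>y\<in>X. y * g \<in> Q" by auto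
  obtain n where "x ^ n \<in> Q" using insert.prems by (auto simp: ideal_radical_def)
  then have n: "x ^ n * g \<in> Q" using subspace_mult[OF Q, of "x ^ n" g] by (simp add: mult.commute)
  define k where "k = (LEAST n. x ^ n * g \<in> Q)"
  have k: "x ^ k * g \<in> Q" unfolding k_def using n by (rule LeastI)
  have "k \<noteq> 0" using k g(2) by (intro notI) simp
  then obtain l where l: "k = Suc l" by (cases k) auto
  have "x ^ l * g \<notin> Q" using not_less_Least[of l "\<lambda>n. x ^ n * g \<in> Q", folded k_def] l by simp
  moreover have "x * (x ^ l * g) \<in> Q" using k l by (simp add: mult_ac)
  moreover have "y * (x ^ l * g) \<in> Q" if "y \<in> X" for y
    using subspace_mult[OF Q, of "y * g" "x ^ l"] g(3) that by (simp add: mult.left_commute)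
  ultimately show ?case using subspace_mult[OF A g(1)] by blast
qed

text \<open>
  The radical has finitely many generators, the variables from \<open>S\<close>, so a multiple \<open>g\<close> of \<open>f\<close> outside
  \<open>Q\<close> is annihilated modulo \<open>Q\<close> by all of it. Conversely, everything that annihilates \<open>g\<close> modulo the
  primary ideal \<open>Q\<close> is in the radical. As \<open>g \<in> A\<close>, annihilation modulo \<open>Q\<close> and modulo \<open>Q \<inter> A\<close> agree.
\<close>

lemma radical_associated:
  fixes Q :: "('x::{finite,linorder}, 'k::idom) mpoly set"
  assumes Q: "primary_ideal Q" and A: "ideal.subspace A" and I: "I = Q \<inter> A"
    and f: "f \<in> A" "f \<notin> Q" and S: "ideal_radical Q = variable_prime S"
  shows "ideal_radical Q \<in> associated_primes I"
proof -
  have sub: "ideal.subspace Q" using Q by (simp add: primary_ideal_def)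
  let ?X = "(\<lambda>j. monomial (Poly_Mapping.single j 1)) ` S :: ('x, 'k) mpoly set"
  have "(monomial (Poly_Mapping.single j 1) :: ('x, 'k) mpoly) \<in> variable_prime S" if "j \<in> S" for j
    using that by (auto simp: variable_prime_def exponent_ideal_def intro!: bexI[of _ j])
  then have "?X \<subseteq> ideal_radical Q" unfolding S by blast
  then obtain g where g: "g \<in> A" "g \<notin> Q" "\<forall>x\<in>?X. x * g \<in> Q"
    using annihilated_by_radical[OF sub A f, of ?X] by auto
  have "ideal.subspace {h. h * g \<in> Q}"
    unfolding ideal.subspace_def
    using sub by (auto simp: ideal.subspace_0 distrib_right mult.assoc intro: subspace_add subspace_mult)
  then have "variable_prime S \<subseteq> {h. h * g \<in> Q}"
    by (rule variable_prime_subset) (use g in auto)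
  moreover have "{h. h * g \<in> Q} \<subseteq> ideal_radical Q"
    using primary_cancel[OF Q] g(2) by auto
  moreover have "{h. h * g \<in> Q} = {h. h * g \<in> I}"
    using subspace_mult[OF A g(1)] I by auto
  ultimately show ?thesis
    using prime_ideal_radical_primary[OF Q] S by (auto simp: associated_primes_def)
qed

text \<open>
  Otherwise pick an element of each \<open>Q i\<close> outside \<open>P\<close>; their product is in the intersection.
\<close>

lemma prime_above_Inter:
  assumes "prime_ideal P" "finite A" "\<And>i. i \<in> A \<Longrightarrow> ideal.subspace (Q i)" "(\<Inter>i\<in>A. Q i) \<subseteq> P"
  obtains i where "i \<in> A" "Q i \<subseteq> P"
proof (rule ccontr)
  assume "\<not> thesis"
  then have "\<forall>i\<in>A. \<exists>b. b \<in> Q i \<and> b \<notin> P" using that by blast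
  then obtain b where b: "\<And>i. i \<in> A \<Longrightarrow> b i \<in> Q i \<and> b i \<notin> P" by metis
  have "prod b A \<in> Q i" if "i \<in> A" for i
    using assms(2) that b[OF that] subspace_mult[OF assms(3)[OF that], of "b i" "prod b (A - {i})"]
    by (simp add: prod.remove[of A i] mult.commute)
  then have "prod b A \<in> P" using assms(4) by blast
  then show False using prime_ideal_prod[OF assms(1,2), of b] b by blast
qed

text \<open>
  The radicals of the components are associated primes, hence minimal since there are no embedded
  ones, and every minimal prime contains a component and so equals its radical. Distinct minimal primes
  are incomparable, so some \<open>s\<close> outside the radical of \<open>Q i\<close> lies in all the other components. It
  multiplies \<open>Q i\<close> into \<open>I\<close>, which identifies \<open>Q i\<close> with the contraction of \<open>I\<close>; the latter is
  known for monomial ideals.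
\<close>

lemma monomial_components:
  fixes I :: "('x::{finite,linorder}, 'k::idom) mpoly set"
  assumes E: "up_closed E" and I: "I = exponent_ideal E"
    and emb: "embedded_primes I = {}"
    and dec: "minimal_primary_decomposition I r Q"
  obtains S where "\<And>i. i \<in> {1..r} \<Longrightarrow> Q i = exponent_ideal (local_exponents (S i) E)"
    and "minimal_primes I = (\<lambda>i. variable_prime (S i)) ` {1..r}"
proof -
  have Q: "primary_ideal (Q i)" "ideal.subspace (Q i)" if "i \<in> {1..r}" for i
    using dec that by (auto simp: minimal_primary_decomposition_def primary_ideal_def)
  have IQ: "I = (\<Inter>i\<in>{1..r}. Q i)"
    using dec by (auto simp: minimal_primary_decomposition_def)
  let ?A = "\<lambda>i. \<Inter>j\<in>{1..r} - {i}. Q j"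
  have IA: "I = Q i \<inter> ?A i" if "i \<in> {1..r}" for i using IQ that by blast
  have A: "ideal.subspace (?A i)" for i
    by (rule ideal.subspace_Inter) (use Q in auto)
  have "\<exists>S. ideal_radical (Q i) = variable_prime S \<and> ideal_radical (Q i) \<in> associated_primes I"
    if i: "i \<in> {1..r}" for i
  proof -
    have "\<forall>i\<in>{1..r}. I \<noteq> ?A i"
      using dec unfolding minimal_primary_decomposition_def by blast
    then have "I \<noteq> ?A i" using i by blast
    then obtain f where f: "f \<in> ?A i" "f \<notin> Q i" using IA[OF i] by blast
    obtain S where S: "ideal_radical (Q i) = variable_prime S"
      by (rule radical_of_component[OF E Q(1)[OF i] A _ f]) (use I IA[OF i] in auto)
    then show ?thesis using radical_associated[OF Q(1)[OF i] A IA[OF i] f S] by blast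
  qed
  then obtain S where S: "\<And>i. i \<in> {1..r} \<Longrightarrow> ideal_radical (Q i) = variable_prime (S i)"
      and ass: "\<And>i. i \<in> {1..r} \<Longrightarrow> ideal_radical (Q i) \<in> associated_primes I"
    by metis
  have min: "ideal_radical (Q i) \<in> minimal_primes I" if "i \<in> {1..r}" for i
    using ass[OF that] emb by (auto simp: embedded_primes_def)
  have "minimal_primes I = (\<lambda>i. ideal_radical (Q i)) ` {1..r}"
  proof
    show "minimal_primes I \<subseteq> (\<lambda>i. ideal_radical (Q i)) ` {1..r}"
    proof
      fix P assume "P \<in> minimal_primes I"
      then have P: "prime_ideal P" "I \<subseteq> P"
          "\<And>P'. prime_ideal P' \<Longrightarrow> I \<subseteq> P' \<Longrightarrow> P' \<subseteq> P \<Longrightarrow> P' = P"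
        by (auto simp: minimal_primes_def)
      obtain i where i: "i \<in> {1..r}" "Q i \<subseteq> P"
        by (rule prime_above_Inter[of P "{1..r}" Q]) (use P Q IQ in auto)
      have "I \<subseteq> ideal_radical (Q i)" using radical_superset[of "Q i"] IQ i(1) by auto
      then have "ideal_radical (Q i) = P"
        by (intro P(3) prime_ideal_radical_primary Q i radical_subset_prime P)
      then show "P \<in> (\<lambda>i. ideal_radical (Q i)) ` {1..r}" using i by auto
    qed
  qed (use min in auto)
  then have "minimal_primes I = (\<lambda>i. variable_prime (S i)) ` {1..r}" using S by simp
  moreover have "Q i = exponent_ideal (local_exponents (S i) E)" if i: "i \<in> {1..r}" for i
  proof -
    let ?P = "ideal_radical (Q i)"
    have "Q i \<subseteq> saturation ?P I"
    proof
      fix a assume a: "a \<in> Q i"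
      have "\<not> ?A i \<subseteq> ?P"
      proof
        assume "?A i \<subseteq> ?P"
        then obtain j where j: "j \<in> {1..r} - {i}" "Q j \<subseteq> ?P"
          using prime_above_Inter[of ?P "{1..r} - {i}" Q]
            prime_ideal_radical_primary[OF Q(1)[OF i]] Q(2) by auto
        then have "ideal_radical (Q j) \<subseteq> ?P"
          by (intro radical_subset_prime prime_ideal_radical_primary Q i)
        then have "ideal_radical (Q j) = ?P"
          using min[OF i] min[of j] j(1) by (auto simp: minimal_primes_def)
        moreover have "inj_on (\<lambda>i. ideal_radical (Q i)) {1..r}"
          using dec unfolding minimal_primary_decomposition_def by blast
        ultimately show False using i j(1) by (metis DiffD1 DiffD2 inj_onD singletonI)
      qed
      then obtain s where s: "s \<in> ?A i" "s \<notin> ?P" by blast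
      have "s * a \<in> Q i" by (rule subspace_mult[OF Q(2)[OF i] a])
      moreover have "s * a \<in> ?A i"
        using subspace_mult[OF A s(1), of a] by (simp only: mult.commute)
      ultimately have "s * a \<in> I" using IA[OF i] by blast
      then show "a \<in> saturation ?P I" using s by (auto simp: saturation_def)
    qed
    moreover have "saturation ?P I \<subseteq> Q i"
      using primary_cancel[OF Q(1)[OF i]] IA[OF i] by (fastforce simp: saturation_def)
    ultimately show ?thesis using saturation_exponent_ideal[OF E] I S[OF i] by (metis subset_antisym)
  qed
  ultimately show ?thesis using that by blast
qed

section \<open>The polynomial ring over the polynomial ring is integrally closed\<close>

text \<open>
  The condition says that a fraction \<open>f / g\<close> whose powers have a common denominator \<open>d\<close> is in the
  ring. Unlike integrality, it is easily compared on leading terms.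
\<close>

definition completely_integrally_closed :: "'a::idom itself \<Rightarrow> bool" where
  "completely_integrally_closed _ \<longleftrightarrow>
     (\<forall>d f g :: 'a. d \<noteq> 0 \<longrightarrow> g \<noteq> 0 \<longrightarrow> (\<forall>n. g ^ n dvd d * f ^ n) \<longrightarrow> g dvd f)"

text \<open>
  Replacing the fraction \<open>f / g\<close> by \<open>f / g - h\<close> keeps the common denominator \<open>d\<close>. This is what allows
  a division algorithm to continue.
\<close>

lemma almost_integral_diff:
  fixes d f g h :: "'a::comm_ring_1"
  assumes "\<And>n. g ^ n dvd d * f ^ n"
  shows "g ^ n dvd d * (f - h * g) ^ n"
proof -
  have "d * (f - h * g) ^ n = (\<Sum>i\<le>n. d * (of_nat (n choose i) * f ^ i * (- (h * g)) ^ (n - i)))"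
    using binomial_ring[of f "- (h * g)" n] by (simp add: sum_distrib_left)
  also have "g ^ n dvd \<dots>"
  proof (rule dvd_sum)
    fix i assume "i \<in> {..n}"
    then have "g ^ n = g ^ i * g ^ (n - i)" using power_split[of i n g] by (simp add: mult.commute)
    also have "\<dots> dvd (d * f ^ i) * (- (h * g)) ^ (n - i)"
      by (intro mult_dvd_mono assms dvd_power_same) simp
    also have "\<dots> dvd d * (of_nat (n choose i) * f ^ i * (- (h * g)) ^ (n - i))"
      by (rule dvdI[of _ _ "of_nat (n choose i)"]) (simp add: mult_ac)
    finally show "g ^ n dvd d * (of_nat (n choose i) * f ^ i * (- (h * g)) ^ (n - i))" .
  qed
  finally show ?thesis .
qed

lemma le_from_multiples:
  fixes a b c :: nat
  assumes "\<And>n. n * a \<le> c + n * b"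
  shows "a \<le> b"
proof (rule ccontr)
  assume "\<not> a \<le> b"
  then have "Suc c * Suc b \<le> Suc c * a" by (intro mult_le_mono2) auto
  also have "\<dots> \<le> c + Suc c * b" by (rule assms)
  finally show False by simp
qed

text \<open>
  The hypothesis on \<open>d, f, g\<close> passes to leading coefficients and to degrees, so the leading term of
  \<open>g\<close> divides that of \<open>f\<close>. Subtracting a multiple of \<open>g\<close> lowers the degree of \<open>f\<close>.
\<close>

lemma completely_integrally_closed_poly:
  assumes "completely_integrally_closed TYPE('a::idom)"
  shows "completely_integrally_closed TYPE('a poly)"
  unfolding completely_integrally_closed_def
proof (intro allI impI)
  fix d f g :: "'a poly"
  assume d: "d \<noteq> 0" and g: "g \<noteq> 0" and "\<forall>n. g ^ n dvd d * f ^ n"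
  then show "g dvd f"
  proof (induction "degree f" arbitrary: f rule: less_induct)
    case less
    show ?case
    proof (cases "f = 0")
      case False
      have n: "lead_coeff g ^ n dvd lead_coeff d * lead_coeff f ^ n"
        "n * degree g \<le> degree d + n * degree f" for n
      proof -
        obtain q where q: "d * f ^ n = g ^ n * q" using less.prems by blast
        have "lead_coeff (d * f ^ n) = lead_coeff (g ^ n * q)" by (simp only: q)
        then show "lead_coeff g ^ n dvd lead_coeff d * lead_coeff f ^ n"
          by (simp add: lead_coeff_mult lead_coeff_power)
        have "d * f ^ n \<noteq> 0" using d False by simp
        then have "q \<noteq> 0" using q by auto
        have "degree (d * f ^ n) = degree (g ^ n * q)" by (simp only: q)
        then have "degree d + n * degree f = n * degree g + degree q"
          using d g False \<open>q \<noteq> 0\<close> by (simp add: degree_mult_eq degree_power_eq)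
        then show "n * degree g \<le> degree d + n * degree f" by simp
      qed
      then have deg: "degree g \<le> degree f" by (intro le_from_multiples[of "degree g" "degree d"])
      have "lead_coeff g dvd lead_coeff f"
        using assms n(1) d g unfolding completely_integrally_closed_def
        by (metis leading_coeff_0_iff)
      then obtain c where c: "lead_coeff f = lead_coeff g * c" by blast
      define h where "h = monom c (degree f - degree g)"
      define f' where "f' = f - h * g"
      have hg: "degree (h * g) \<le> degree f"
        using degree_mult_le[of h g] degree_monom_le[of c "degree f - degree g"] deg
        unfolding h_def by linarith
      have "coeff (h * g) (degree f) = lead_coeff f"
        using coeff_monom_mult[of c "degree f - degree g" g "degree f"] c deg
        by (simp add: h_def mult.commute)
      then have c0: "coeff f' (degree f) = 0" by (simp add: f'_def)
      have "degree f' \<le> degree f" using hg by (simp add: f'_def degree_diff_le)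
      then have lt: "degree f' < degree f" if "f' \<noteq> 0"
        using c0 that by (metis le_neq_implies_less leading_coeff_0_iff)
      have "\<forall>n. g ^ n dvd d * f' ^ n"
        unfolding f'_def using less.prems by (intro allI almost_integral_diff) auto
      then have "g dvd f'"
        using less.hyps[of f'] d g lt by (cases "f' = 0") auto
      then show ?thesis
        using dvd_add[of g f' "h * g"] by (simp add: f'_def)
    qed simp
  qed
qed

text \<open>
  In a set of exponent vectors, minimize the coordinates one after the other, starting with the least
  index, which is the most significant one.
\<close>

lemma wf_lex_exponents:
  "wf {(m, n :: 'x::{finite,linorder} \<Rightarrow>\<^sub>0 nat). m < n}"
proof (rule wfI_min)
  have *: "\<exists>m\<in>A. \<forall>n\<in>A. \<not> (\<exists>k\<in>K. lookup n k < lookup m k \<and> (\<forall>l\<in>K. l < k \<longrightarrow> lookup n l = lookup m l))"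
    if "A \<noteq> {}" for A :: "('x \<Rightarrow>\<^sub>0 nat) set" and K :: "'x set"
  proof -
    have "finite K" by simp
    then show ?thesis using that
    proof (induction K arbitrary: A rule: finite_linorder_min_induct)
      case empty
      then show ?case by auto
    next
      case (insert b K)
      define v where "v = (LEAST v. \<exists>m\<in>A. lookup m b = v)"
      have v: "\<exists>m\<in>A. lookup m b = v" unfolding v_def by (rule LeastI_ex) (use insert.prems in auto)
      have vle: "v \<le> lookup m b" if "m \<in> A" for m
        unfolding v_def by (rule Least_le) (use that in auto)
      obtain m where m: "m \<in> A" "lookup m b = v"
        "\<forall>n\<in>{m\<in>A. lookup m b = v}. \<not> (\<exists>k\<in>K. lookup n k < lookup m k \<and> (\<forall>l\<in>K. l < k \<longrightarrow> lookup n l = lookup m l))"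
        using insert.IH[of "{m\<in>A. lookup m b = v}"] v by auto
      have "\<not> (\<exists>k\<in>insert b K. lookup n k < lookup m k \<and> (\<forall>l\<in>insert b K. l < k \<longrightarrow> lookup n l = lookup m l))"
        if n: "n \<in> A" for n
      proof
        assume "\<exists>k\<in>insert b K. lookup n k < lookup m k \<and> (\<forall>l\<in>insert b K. l < k \<longrightarrow> lookup n l = lookup m l)"
        then obtain k where k: "k \<in> insert b K" "lookup n k < lookup m k"
          "\<forall>l\<in>insert b K. l < k \<longrightarrow> lookup n l = lookup m l" by blast
        have "k \<noteq> b" using k(2) m(2) vle[OF n] by auto
        then have "k \<in> K" "lookup n b = v" using k insert.hyps m(2) by auto
        then show False using m(3) n k by auto
      qed
      then show ?case using m(1) by blast
    qed
  qed
  fix x :: "'x \<Rightarrow>\<^sub>0 nat" and A assume "x \<in> A"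
  then obtain m where "m \<in> A"
      "\<forall>n\<in>A. \<not> (\<exists>k. lookup n k < lookup m k \<and> (\<forall>l. l < k \<longrightarrow> lookup n l = lookup m l))"
    using *[of A UNIV] by auto
  then show "\<exists>z\<in>A. \<forall>y. (y, z) \<in> {(m, n). m < n} \<longrightarrow> y \<notin> A"
    by (auto simp: less_poly_mapping.rep_eq less_fun_def intro!: bexI[of _ m])
qed

definition lead_exp :: "('x::linorder, 'k::zero) mpoly \<Rightarrow> 'x \<Rightarrow>\<^sub>0 nat" where
  "lead_exp f = Max (keys f)"

lemma lead_exp_in_keys: "f \<noteq> 0 \<Longrightarrow> lead_exp f \<in> keys f"
  unfolding lead_exp_def by (rule Max_in) auto

lemma le_lead_exp: "m \<in> keys f \<Longrightarrow> m \<le> lead_exp f"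
  by (simp add: lead_exp_def)

lemma lookup_lead_exp: "f \<noteq> 0 \<Longrightarrow> lookup f (lead_exp f) \<noteq> 0"
  using lead_exp_in_keys by (simp add: in_keys_iff)

lemma lookup_mult_lead_exp:
  fixes f g :: "('x::linorder, 'k::idom) mpoly"
  shows "lookup (f * g) (lead_exp f + lead_exp g) = lookup f (lead_exp f) * lookup g (lead_exp g)"
proof (rule lookup_mult_unique)
  fix m n assume *: "m \<in> keys f" "n \<in> keys g" "m + n = lead_exp f + lead_exp g"
  have le: "m \<le> lead_exp f" "n \<le> lead_exp g" using * by (auto intro: le_lead_exp)
  have "\<not> m < lead_exp f"
  proof
    assume "m < lead_exp f"
    then show False using add_less_le_mono[OF _ le(2), of m "lead_exp f"] *(3) by simp
  qed
  then have "m = lead_exp f" using le(1) by (metis order.order_iff_strict)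
  then show "m = lead_exp f \<and> n = lead_exp g" using *(3) by auto
qed

lemma lead_exp_mult:
  fixes f g :: "('x::linorder, 'k::idom) mpoly"
  assumes "f \<noteq> 0" "g \<noteq> 0"
  shows "lead_exp (f * g) = lead_exp f + lead_exp g"
proof (rule antisym)
  have "lead_exp (f * g) \<in> keys (f * g)" using assms by (intro lead_exp_in_keys) simp
  then show "lead_exp (f * g) \<le> lead_exp f + lead_exp g"
    by (auto elim!: keys_mult_obtain intro!: add_mono le_lead_exp)
  show "lead_exp f + lead_exp g \<le> lead_exp (f * g)"
    using assms lookup_mult_lead_exp[of f g]
    by (intro le_lead_exp) (simp add: in_keys_iff lookup_lead_exp)
qed

lemma lookup_lead_exp_power:
  fixes f :: "('x::linorder, 'k::idom) mpoly"
  assumes "f \<noteq> 0"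
  shows "lookup (lead_exp (f ^ n)) j = n * lookup (lead_exp f) j"
proof (induction n)
  case 0
  then show ?case by (simp add: lead_exp_def)
next
  case (Suc n)
  then show ?case using assms by (simp add: lead_exp_mult lookup_add)
qed

text \<open>
  The same division as in one variable, with leading exponents for the lexicographic order instead of
  degrees; it ends because this order is well-founded.
\<close>

lemma completely_integrally_closed_mpoly:
  "completely_integrally_closed TYPE(('x::{finite,linorder}, 'k::field) mpoly)"
  unfolding completely_integrally_closed_def
proof (intro allI impI)
  fix d f g :: "('x, 'k) mpoly"
  assume d: "d \<noteq> 0" and g: "g \<noteq> 0" and "\<forall>n. g ^ n dvd d * f ^ n"
  then show "g dvd f"
  proof (induction "lead_exp f" arbitrary: f rule: wf_induct_rule[OF wf_lex_exponents])
    case (1 f)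
    show ?case
    proof (cases "f = 0")
      case False
      have "n * lookup (lead_exp g) j \<le> lookup (lead_exp d) j + n * lookup (lead_exp f) j" for n j
      proof -
        obtain q where q: "d * f ^ n = g ^ n * q" using 1(4) by blast
        have "d * f ^ n \<noteq> 0" using d False by simp
        then have "q \<noteq> 0" using q by auto
        have "lead_exp d + lead_exp (f ^ n) = lead_exp (g ^ n) + lead_exp q"
          using q \<open>q \<noteq> 0\<close> d g False by (metis lead_exp_mult power_not_zero)
        then have "lookup (lead_exp d) j + n * lookup (lead_exp f) j =
            n * lookup (lead_exp g) j + lookup (lead_exp q) j"
          using g False by (metis lookup_add lookup_lead_exp_power)
        then show ?thesis by simp
      qed
      then have le: "lookup (lead_exp g) j \<le> lookup (lead_exp f) j" for j
        by (rule le_from_multiples)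
      define c where "c = lookup f (lead_exp f) / lookup g (lead_exp g)"
      define h where "h = Poly_Mapping.single (lead_exp f - lead_exp g) c"
      have c: "c \<noteq> 0" using False g by (simp add: c_def lookup_lead_exp)
      have h: "h \<noteq> 0" "lead_exp h = lead_exp f - lead_exp g" "lookup h (lead_exp h) = c"
        using c by (auto simp: h_def lead_exp_def simp flip: keys_eq_empty)
      have e: "lead_exp h + lead_exp g = lead_exp f"
        unfolding h(2) using le by (intro poly_mapping_eqI) (simp add: lookup_add lookup_minus)
      define f' where "f' = f - h * g"
      have "lookup (h * g) (lead_exp f) = lookup f (lead_exp f)"
        using lookup_mult_lead_exp[of h g] h(3) g unfolding e by (simp add: c_def lookup_lead_exp)
      then have 0: "lookup f' (lead_exp f) = 0" by (simp add: f'_def lookup_minus)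
      have lt: "lead_exp f' < lead_exp f" if "f' \<noteq> 0"
      proof -
        have *: "lead_exp f' \<in> keys f'" using that by (rule lead_exp_in_keys)
        then have "lead_exp f' \<in> keys f \<or> lead_exp f' \<in> keys (h * g)"
          by (auto simp: f'_def in_keys_iff lookup_minus)
        then have "lead_exp f' \<le> lead_exp f"
          using le_lead_exp[of _ "h * g"] le_lead_exp[of _ f] lead_exp_mult[OF h(1) g] e by auto
        moreover have "lead_exp f' \<noteq> lead_exp f" using * 0 by (auto simp: in_keys_iff)
        ultimately show ?thesis by simp
      qed
      have "\<forall>n. g ^ n dvd d * f' ^ n"
        unfolding f'_def using 1(4) by (intro allI almost_integral_diff) auto
      then have "g dvd f'" using 1(1)[of f'] lt d g by (cases "f' = 0") auto
      then show ?thesis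
        using dvd_add[of g f' "h * g"] by (simp add: f'_def)
    qed simp
  qed
qed

text \<open>
  If \<open>x = a / b\<close> satisfies a monic equation of degree \<open>d\<close>, every power of \<open>x\<close> is a combination of
  \<open>1, x, \<dots>, x\<^sup>d\<^sup>-\<^sup>1\<close>, so \<open>b\<^sup>d\<close> is a common denominator of all powers.
\<close>

lemma integral_imp_mem_completely_integrally_closed:
  fixes x :: "'a::idom fract"
  assumes cic: "completely_integrally_closed TYPE('a)" and x: "integral_over UNIV x"
  shows "x \<in> range to_fract"
proof -
  obtain f where f: "lead_coeff f = 1" "\<And>i. coeff f i \<in> range to_fract" "poly f x = 0"
    using x by (auto simp: integral_over_def)
  define d where "d = degree f"
  obtain a b where ab: "x = Fraction_Field.Fract a b" "b \<noteq> 0" by (cases x) auto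
  have pow: "to_fract c ^ n = to_fract (c ^ n)" for c :: 'a and n by (induction n) auto
  have xb: "x * to_fract b = to_fract a" using ab by (simp add: Fract_conv_to_fract)
  have xd: "x ^ d = - (\<Sum>i<d. coeff f i * x ^ i)"
  proof -
    have "poly f x = (\<Sum>i<d. coeff f i * x ^ i) + x ^ d"
      using f(1) by (simp add: poly_altdef d_def flip: lessThan_Suc_atMost)
    then show ?thesis using f(3) by (simp add: eq_neg_iff_add_eq_0 add.commute)
  qed
  have R: "u + v \<in> range to_fract" "u * v \<in> range to_fract"
    if "u \<in> range to_fract" "v \<in> range to_fract" for u v :: "'a fract"
    using that by (auto simp flip: to_fract_add to_fract_mult)
  have Rneg: "- u \<in> range to_fract" if "u \<in> range to_fract" for u :: "'a fract"
    using that by (auto simp flip: to_fract_uminus)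
  have Rsum: "(\<Sum>i\<in>A. u i) \<in> range to_fract"
    if "\<And>i. i \<in> A \<Longrightarrow> u i \<in> range to_fract" for u :: "nat \<Rightarrow> 'a fract" and A
    using that by (induction A rule: infinite_finite_induct) (auto intro: R simp flip: to_fract_0)
  have "to_fract b ^ d * x ^ n \<in> range to_fract" for n
  proof (induction n rule: less_induct)
    case (less n)
    show ?case
    proof (cases "n < d")
      case True
      then have "to_fract b ^ d = to_fract b ^ (d - n) * to_fract b ^ n" by (intro power_split) simp
      then have "to_fract b ^ d * x ^ n = to_fract b ^ (d - n) * (x * to_fract b) ^ n"
        by (simp add: power_mult_distrib)
      also have "\<dots> = to_fract (b ^ (d - n) * a ^ n)"
        unfolding xb by (simp add: pow)
      finally show ?thesis by blast
    next
      case False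
      then have "to_fract b ^ d * x ^ n = to_fract b ^ d * (x ^ (n - d) * x ^ d)"
        by (subst power_split[of d n x]) simp_all
      also have "\<dots> = - (\<Sum>i<d. to_fract b ^ d * (x ^ (n - d) * (coeff f i * x ^ i)))"
        unfolding xd by (simp add: sum_distrib_left)
      also have "\<dots> = - (\<Sum>i<d. coeff f i * (to_fract b ^ d * x ^ (n - d + i)))"
        by (simp add: power_add mult_ac)
      also have "\<dots> \<in> range to_fract"
      proof (rule Rneg[OF Rsum])
        fix i assume "i \<in> {..<d}"
        then show "coeff f i * (to_fract b ^ d * x ^ (n - d + i)) \<in> range to_fract"
          using False by (intro R(2) f(2) less.IH) auto
      qed
      finally show ?thesis .
    qed
  qed
  have "b ^ n dvd b ^ d * a ^ n" for n
  proof -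
    obtain w where w: "to_fract b ^ d * x ^ n = to_fract w"
      using \<open>to_fract b ^ d * x ^ n \<in> range to_fract\<close> by blast
    have "to_fract (b ^ d * a ^ n) = to_fract b ^ d * (x * to_fract b) ^ n"
      by (simp add: pow xb)
    also have "\<dots> = to_fract (w * b ^ n)"
      using w by (simp add: power_mult_distrib pow mult_ac)
    finally have "b ^ d * a ^ n = w * b ^ n" by (simp only: to_fract_eq_iff)
    then show ?thesis by simp
  qed
  then have "b dvd a" using cic ab(2) unfolding completely_integrally_closed_def
    by (metis power_not_zero)
  then obtain q where "a = b * q" by blast
  then have "x = to_fract q" using ab by (simp add: Fract_conv_to_fract)
  then show ?thesis by simp
qed

section \<open>Rees algebras\<close>

lemma integral_over_mono: "A \<subseteq> B \<Longrightarrow> integral_over A x \<Longrightarrow> integral_over B x"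
  unfolding integral_over_def by blast

text \<open>
  If \<open>x\<close> is a root of \<open>f = \<Sum> c\<^sub>i X\<^sup>i\<close> of degree \<open>d\<close>, then \<open>s x\<close> is a root of \<open>\<Sum> s\<^sup>d\<^sup>-\<^sup>i c\<^sub>i X\<^sup>i\<close>, whose
  coefficients below the leading one all carry a factor \<open>s\<close>.
\<close>

lemma integral_over_scale:
  fixes x :: "'a::idom fract"
  assumes f: "lead_coeff f = 1" "poly f x = 0"
    and A: "0 \<in> A" "1 \<in> A" "\<And>a. a \<in> A \<Longrightarrow> s * a \<in> A"
    and fs: "\<And>i. to_fract s * coeff f i \<in> to_fract ` A"
  shows "integral_over A (to_fract s * x)"
proof -
  define d where "d = degree f"
  define F where "F = (\<Sum>i\<le>d. monom (to_fract s ^ (d - i) * coeff f i) i)"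
  have cF: "coeff F j = (if j \<le> d then to_fract s ^ (d - j) * coeff f j else 0)" for j
    by (simp add: F_def coeff_sum)
  have "degree F = d"
    using f(1) by (intro antisym degree_le le_degree) (auto simp: cF d_def)
  then have 1: "lead_coeff F = 1" using f(1) by (simp add: cF d_def)
  have "poly F (to_fract s * x) = (\<Sum>i\<le>d. to_fract s ^ d * (coeff f i * x ^ i))"
    unfolding F_def poly_sum
  proof (rule sum.cong[OF refl])
    fix i assume "i \<in> {..d}"
    then have "to_fract s ^ d = to_fract s ^ (d - i) * to_fract s ^ i" by (intro power_split) simp
    then show "poly (monom (to_fract s ^ (d - i) * coeff f i) i) (to_fract s * x) =
        to_fract s ^ d * (coeff f i * x ^ i)"
      by (simp add: poly_monom power_mult_distrib mult_ac)
  qed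
  also have "\<dots> = to_fract s ^ d * poly f x" by (simp add: poly_altdef d_def sum_distrib_left)
  finally have 2: "poly F (to_fract s * x) = 0" using f(2) by simp
  have 3: "to_fract s ^ Suc n * coeff f i \<in> to_fract ` A" for n i
  proof (induction n)
    case (Suc n)
    then obtain a where "a \<in> A" "to_fract s ^ Suc n * coeff f i = to_fract a" by blast
    then have "to_fract s ^ Suc (Suc n) * coeff f i = to_fract (s * a)" "s * a \<in> A"
      using A(3) by (auto simp: mult_ac)
    then show ?case by blast
  qed (use fs in simp)
  have "coeff F j \<in> to_fract ` A" for j
  proof -
    consider "j < d" | "j = d" | "j > d" by linarith
    then show ?thesis
    proof cases
      case 1
      then have "d - j = Suc (d - j - 1)" by simp
      then show ?thesis using 3[of "d - j - 1" j] 1 by (simp add: cF)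
    next
      case 2
      then have "coeff F j = to_fract 1" using f(1) by (simp add: cF d_def)
      then show ?thesis using A(2) by blast
    next
      case 3
      then have "coeff F j = to_fract 0" by (simp add: cF)
      then show ?thesis using A(1) by blast
    qed
  qed
  then show ?thesis using 1 2 unfolding integral_over_def by blast
qed

text \<open>
  A fraction integral over the intersection is integral over each of the rings. Its values in the
  different rings are the same element of the ambient domain, in which the fraction lies because that
  domain is integrally closed.
\<close>

lemma normal_domain_Inter:
  fixes A :: "'i \<Rightarrow> 'a::idom set"
  assumes "completely_integrally_closed TYPE('a)" "\<And>i. i \<in> X \<Longrightarrow> normal_domain (A i)"
  shows "normal_domain (\<Inter>i\<in>X. A i)"
  unfolding normal_domain_def
proof (intro ballI impI)
  let ?B = "\<Inter>i\<in>X. A i"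
  fix x assume x: "x \<in> fraction_field ?B" "integral_over ?B x"
  then have "x \<in> range to_fract"
    by (intro integral_imp_mem_completely_integrally_closed assms) (auto intro: integral_over_mono)
  then obtain w where w: "x = to_fract w" by blast
  have "w \<in> A i" if "i \<in> X" for i
  proof -
    have "?B \<subseteq> A i" using that by auto
    then have "x \<in> fraction_field (A i)" "integral_over (A i) x"
      using x unfolding fraction_field_def by (blast, blast intro: integral_over_mono)
    then have "x \<in> to_fract ` A i" using assms(2)[OF that] by (auto simp: normal_domain_def)
    then show ?thesis using w by auto
  qed
  then show "x \<in> to_fract ` ?B" using w by auto
qed

text \<open>
  Normality passes from \<open>A\<close> to a larger ring \<open>B\<close> that has the same localization at the complement of
  \<open>P\<close> (\<open>up\<close>) and is saturated with respect to that complement in the polynomial ring (\<open>down\<close>). The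
  fraction and the finitely many coefficients of an integral equation need one multiplier \<open>s\<close>.
\<close>

lemma normal_domain_descent:
  fixes A B :: "'a::idom poly set"
  assumes cic: "completely_integrally_closed TYPE('a)"
    and P: "prime_ideal P"
    and A: "normal_domain A" "0 \<in> A" "1 \<in> A" "\<And>s p. p \<in> A \<Longrightarrow> smult s p \<in> A"
    and AB: "A \<subseteq> B"
    and up: "\<And>p. p \<in> B \<Longrightarrow> \<exists>s. s \<notin> P \<and> smult s p \<in> A"
    and down: "\<And>s p. s \<notin> P \<Longrightarrow> smult s p \<in> B \<Longrightarrow> p \<in> B"
  shows "normal_domain B"
  unfolding normal_domain_def
proof (intro ballI impI)
  fix x assume x: "x \<in> fraction_field B" "integral_over B x"
  have "x \<in> range to_fract"
    using x(2) by (intro integral_imp_mem_completely_integrally_closed completely_integrally_closed_poly cic)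
      (auto intro: integral_over_mono)
  then obtain w where w: "x = to_fract w" by blast
  obtain a b where ab: "x = Fraction_Field.Fract a b" "a \<in> B" "b \<in> B" "b \<noteq> 0"
    using x(1) by (auto simp: fraction_field_def)
  obtain f where f: "lead_coeff f = 1" "\<And>i. coeff f i \<in> to_fract ` B" "poly f x = 0"
    using x(2) by (auto simp: integral_over_def)
  have "\<forall>i. \<exists>y. y \<in> B \<and> coeff f i = to_fract y" using f(2) by blast
  then obtain c where c: "\<And>i. c i \<in> B" "\<And>i. coeff f i = to_fract (c i)"
    unfolding choice_iff by blast
  let ?X = "{a, b} \<union> c ` {..degree f}"
  obtain s where s: "s \<notin> P" "\<And>p. p \<in> ?X \<Longrightarrow> smult s p \<in> A"
    by (rule common_multiplier[OF P, of ?X "\<lambda>s p. smult s p \<in> A"])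
       (use up ab c A(4) in \<open>auto simp flip: smult_smult\<close>)
  have "s \<noteq> 0" using s(1) P by (auto simp: prime_ideal_def ideal.subspace_0)
  have "[:s:] \<noteq> 0" using \<open>s \<noteq> 0\<close> by simp
  then have "to_fract [:s:] * x = Fraction_Field.Fract ([:s:] * ([:s:] * a)) ([:s:] * b)"
    using ab by (simp add: Fract_conv_to_fract del: mult_pCons_left)
  moreover have "[:s:] * ([:s:] * a) \<in> A" "[:s:] * b \<in> A" "[:s:] * b \<noteq> 0"
    using A(4)[OF s(2)[of a], of s] s(2)[of b] ab(4) \<open>s \<noteq> 0\<close> by simp_all
  ultimately have "to_fract [:s:] * x \<in> fraction_field A"
    unfolding fraction_field_def by blast
  moreover have "integral_over A (to_fract [:s:] * x)"
  proof (rule integral_over_scale[OF f(1,3) A(2,3)])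
    show "[:s:] * p \<in> A" if "p \<in> A" for p using A(4)[OF that, of s] by simp
    fix i
    have "[:s:] * c i \<in> A"
    proof (cases "i \<le> degree f")
      case True
      then show ?thesis using s(2)[of "c i"] by auto
    next
      case False
      then have "to_fract (c i) = 0" unfolding c(2)[symmetric] by (simp add: coeff_eq_0)
      then show ?thesis using A(2) by simp
    qed
    then show "to_fract [:s:] * coeff f i \<in> to_fract ` A"
      unfolding c(2) by (metis imageI to_fract_mult)
  qed
  ultimately have "to_fract [:s:] * x \<in> to_fract ` A" using A(1) by (auto simp: normal_domain_def)
  then have "to_fract ([:s:] * w) \<in> to_fract ` A" unfolding w to_fract_mult .
  then have "[:s:] * w \<in> A" by (metis imageE to_fract_eq_iff)
  then have "smult s w \<in> A" by simp
  then have "w \<in> B" using down[OF s(1)] AB by blast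
  then show "x \<in> to_fract ` B" using w by auto
qed

lemma symbolic_power_eq_Inter:
  fixes I :: "('x::{finite,linorder}, 'k::idom) mpoly set"
  assumes "up_closed E" "I = exponent_ideal E"
    and "\<And>i. i \<in> X \<Longrightarrow> Q i = exponent_ideal (local_exponents (S i) E)"
    and "minimal_primes I = (\<lambda>i. variable_prime (S i)) ` X"
  shows "symbolic_power I k = (\<Inter>i\<in>X. ideal_power (Q i) k)"
  unfolding symbolic_power_eq_saturation assms(4)
  using assms(1-3) by (simp add: saturation_ideal_power)

theorem proposition3:
  fixes I :: "('x::{finite,linorder}, 'k::field) mpoly set"
    and r :: nat
    and Q :: "nat \<Rightarrow> ('x, 'k) mpoly set"
  assumes "monomial_ideal I"
    and "embedded_primes I = {}"
    and "minimal_primary_decomposition I r Q"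
  shows "normal_domain (symbolic_rees_algebra I) \<longleftrightarrow>
         (\<forall>i\<in>{1..r}. normal_domain (rees_algebra (Q i)))"
proof -
  obtain E where E: "up_closed E" "I = exponent_ideal E"
    using monomial_ideal_exponents[OF assms(1)] by blast
  obtain S where S: "\<And>i. i \<in> {1..r} \<Longrightarrow> Q i = exponent_ideal (local_exponents (S i) E)"
    and min: "minimal_primes I = (\<lambda>i. variable_prime (S i)) ` {1..r}"
    using monomial_components[OF E assms(2,3)] by blast
  have symb: "symbolic_power I k = (\<Inter>i\<in>{1..r}. ideal_power (Q i) k)" for k
    by (rule symbolic_power_eq_Inter[OF E S min])
  have rees: "symbolic_rees_algebra I = (\<Inter>i\<in>{1..r}. rees_algebra (Q i))"
    unfolding symbolic_rees_algebra_def rees_algebra_def symb by blast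
  have cic: "completely_integrally_closed TYPE(('x, 'k) mpoly)"
    by (rule completely_integrally_closed_mpoly)
  show ?thesis
  proof
    assume "\<forall>i\<in>{1..r}. normal_domain (rees_algebra (Q i))"
    then show "normal_domain (symbolic_rees_algebra I)"
      unfolding rees by (intro normal_domain_Inter completely_integrally_closed_poly cic) auto
  next
    assume norm: "normal_domain (symbolic_rees_algebra I)"
    have sub: "ideal.subspace (symbolic_power I k)" for k
      unfolding symb by (rule ideal.subspace_Inter) (auto intro: subspace_ideal_power)
    show "\<forall>i\<in>{1..r}. normal_domain (rees_algebra (Q i))"
    proof
      fix i assume i: "i \<in> {1..r}"
      let ?P = "variable_prime (S i) :: ('x, 'k) mpoly set"
      have P: "prime_ideal ?P" by (rule prime_variable_prime)
      have sat: "saturation ?P (ideal_power I k) = ideal_power (Q i) k" for k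
        unfolding S[OF i] E(2) by (rule saturation_ideal_power[OF E(1)])
      have satQ: "a \<in> ideal_power (Q i) k" if s: "s \<notin> ?P" "s * a \<in> ideal_power (Q i) k" for s a k
      proof -
        obtain t where "t \<notin> ?P" "t * (s * a) \<in> ideal_power I k"
          using s(2) unfolding sat[symmetric] by (auto simp: saturation_def)
        then have "a \<in> saturation ?P (ideal_power I k)"
          using prime_ideal_mult[OF P _ s(1)] by (auto simp: saturation_def mult.assoc[symmetric])
        then show ?thesis unfolding sat .
      qed
      have powI: "ideal_power I k \<subseteq> symbolic_power I k" for k
        unfolding symbolic_power_eq_saturation
        by (intro INF_greatest saturation_superset) (simp add: minimal_primes_def)
      show "normal_domain (rees_algebra (Q i))"
      proof (rule normal_domain_descent[OF cic P norm])
        show "symbolic_rees_algebra I \<subseteq> rees_algebra (Q i)" unfolding rees using i by blast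
        show "0 \<in> symbolic_rees_algebra I" "1 \<in> symbolic_rees_algebra I"
          by (auto simp: symbolic_rees_algebra_def ideal.subspace_0[OF sub])
        show "smult s p \<in> symbolic_rees_algebra I" if "p \<in> symbolic_rees_algebra I" for s p
          using that by (auto simp: symbolic_rees_algebra_def intro: subspace_mult[OF sub])
        show "p \<in> rees_algebra (Q i)" if "s \<notin> ?P" "smult s p \<in> rees_algebra (Q i)" for s p
          using that satQ by (auto simp: rees_algebra_def)
        fix p assume p: "p \<in> rees_algebra (Q i)"
        obtain s where s: "s \<notin> ?P"
            "\<And>k. k \<in> {1..degree p} \<Longrightarrow> s * coeff p k \<in> ideal_power I k"
        proof (rule common_multiplier[OF P, of "{1..degree p}" "\<lambda>s k. s * coeff p k \<in> ideal_power I k"])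
          show "\<exists>s. s \<notin> ?P \<and> s * coeff p k \<in> ideal_power I k" if k: "k \<in> {1..degree p}" for k
          proof -
            have "coeff p k \<in> saturation ?P (ideal_power I k)"
              unfolding sat using p k by (simp add: rees_algebra_def)
            then show ?thesis by (simp add: saturation_def)
          qed
          show "t * s * coeff p k \<in> ideal_power I k" if "s * coeff p k \<in> ideal_power I k" for s t k
            using subspace_mult[OF subspace_ideal_power that, of t] by (simp add: mult.assoc)
        qed auto
        have "s * coeff p k \<in> symbolic_power I k" if "k \<ge> 1" for k
        proof (cases "k \<le> degree p")
          case True
          then show ?thesis using s(2)[of k] powI that by auto
        next
          case False
          then show ?thesis by (simp add: coeff_eq_0 ideal.subspace_0[OF sub])
        qed
        then show "\<exists>s. s \<notin> ?P \<and> smult s p \<in> symbolic_rees_algebra I"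
          using s(1) by (auto simp: symbolic_rees_algebra_def)
      qed
    qed
  qed
qed

end
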